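(* Let $p \in \mathcal{S}_n$ and $\pi = \varphi(p)$. Then $\pi$ is an involution if and only if $\mathrm{rev}(p) = p$.
   Context: Schröder paths. A Schröder path of length $n\ge 1$ is a lattice path from $(0,0)$ to $(n,n)$ with steps from $\{\mathsf{e}=(1,0),\ \mathsf{n}=(0,1),\ \mathsf{d}=(1,1)\}$ that does not pass below the line $y=x$; it is written as a word in these letters. $\mathcal{S}_n$ is the set of Schröder paths of length $n$, and $\mathcal{S}_0$ contains only the empty path $\emptyset$. $\mathrm{rev}(p)$ is the path obtained by applying the steps of $p$ in reverse order and then replacing every $\mathsf{e}$ by $\mathsf{n}$ and vice versa. Permutations. $\mathfrak{S}_m(1243,2143)$ is the set of permutations of $\{1,\ldots,m\}$, in one-line notation, having no subsequence order-isomorphic to $1243$ or to $2143$. An involution is a permutation with $\pi=\pi^{-1}$ (the identity included). The Egge–Mansour bijection $\varphi:\mathcal{S}_n\to\mathfrak{S}_{n+1}(1243,2143)$ (known to be a bijection). For $i=1,\ldots,n$ let $s_i$ act on a one-line permutation by exchanging the entries in positions $i$ and $i+1$; products act right to left: $s_is_j\pi=s_i(s_j(\pi))$. Given $p\in\mathcal{S}_n$: let $\Gamma_{r,s}$ be the unit square with opposite corners $(r-1,s-1)$ and $(r,s)$. Label by $r$ each $\Gamma_{r,s}$ whose top-left corner $(r-1,s)$ lies on or below $p$ and strictly above the line $y=x$. Successively for $i=1,2,\ldots$, as long as labeled squares remain: take the labeled square $\Gamma_{r,s}$ with largest label $r$ and move diagonally to the lower left through $\Gamma_{r,s},\Gamma_{r-1,s-1},\ldots$,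 stopping at the first square $\Gamma_{r-j,s-j}$ whose left side is an $\mathsf{n}$ step of $p$; set $\sigma_i=s_rs_{r-1}\cdots s_{r-j}$ and remove the labels used. If $\sigma_1,\ldots,\sigma_k$ are the products obtained, then $\varphi(p)=\sigma_k\sigma_{k-1}\cdots\sigma_1(n+1,n,\ldots,2,1)$. (For example $\varphi(\mathsf{d})=(2,1)$, $\varphi(\mathsf{n}\mathsf{e})=(1,2)$, and $\varphi(\emptyset)=(1)$.) *)

theory Defs
  imports "HOL-Combinatorics.Permutations"
begin

datatype step = East | North | Diag

fun step_vec :: "step \<Rightarrow> nat \<times> nat" where
  "step_vec East = (1, 0)"
| "step_vec North = (0, 1)"
| "step_vec Diag = (1, 1)"

definition endpoint :: "step list \<Rightarrow> nat \<times> nat" where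
  "endpoint p = (sum_list (map (fst \<circ> step_vec) p), sum_list (map (snd \<circ> step_vec) p))"

definition vertices :: "step list \<Rightarrow> (nat \<times> nat) set" where
  "vertices p = {endpoint (take k p) |k. k \<le> length p}"

definition schroeder_paths :: "nat \<Rightarrow> step list set" where
  "schroeder_paths n = {p. endpoint p = (n, n) \<and> (\<forall>(x, y) \<in> vertices p. x \<le> y)}"

fun swap_step :: "step \<Rightarrow> step" where
  "swap_step East = North"
| "swap_step North = East"
| "swap_step Diag = Diag"

definition path_rev :: "step list \<Rightarrow> step list" where
  "path_rev p = map swap_step (rev p)"

text \<open>A lattice point lies on or below a path iff some vertex of the path lies weakly above it
  in the same vertical line: a path meets a line \<open>x = c\<close> with \<open>c\<close> an integer in a segment
  whose endpoints are vertices.\<close>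

definition on_or_below :: "nat \<times> nat \<Rightarrow> step list \<Rightarrow> bool" where
  "on_or_below P p \<longleftrightarrow> (\<exists>y. (fst P, y) \<in> vertices p \<and> snd P \<le> y)"

text \<open>The pair \<open>(r, s)\<close> with \<open>r, s \<ge> 1\<close> stands for the unit square with opposite corners
  \<open>(r - 1, s - 1)\<close> and \<open>(r, s)\<close>; its label, if it has one, is \<open>r\<close>.\<close>

definition labeled_squares :: "nat \<Rightarrow> step list \<Rightarrow> (nat \<times> nat) set" where
  "labeled_squares n p = {(r, s). r \<in> {1..n} \<and> s \<in> {1..n} \<and> on_or_below (r - 1, s) p \<and> r - 1 < s}"

definition left_side_is_north :: "step list \<Rightarrow> nat \<times> nat \<Rightarrow> bool" where
  "left_side_is_north p = (\<lambda>(r, s). r \<ge> 1 \<and> s \<ge> 1 \<and>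
     (\<exists>k < length p. p ! k = North \<and> endpoint (take k p) = (r - 1, s - 1)))"

text \<open>The number \<open>j\<close> of diagonal moves to the lower left made from a given square. The bound
  on \<open>j\<close> keeps the truncated subtraction on the naturals exact.\<close>

definition diag_moves :: "step list \<Rightarrow> nat \<times> nat \<Rightarrow> nat" where
  "diag_moves p = (\<lambda>(r, s). LEAST j. j < r \<and> j < s \<and> left_side_is_north p (r - j, s - j))"

text \<open>The words \<open>\<sigma>\<^sub>1, \<dots>, \<sigma>\<^sub>k\<close> obtained from the set \<open>L\<close> of squares that still carry a label;
  the list \<open>[r, r - 1, \<dots>, r - j]\<close> stands for \<open>s\<^sub>r s\<^sub>r\<^sub>-\<^sub>1 \<dots> s\<^sub>r\<^sub>-\<^sub>j\<close>. Starting from all labeled squares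
  of a Schroeder path, the largest remaining label is always carried by exactly one square, so
  taking the topmost square of its column never makes a choice.\<close>

function em_words :: "step list \<Rightarrow> (nat \<times> nat) set \<Rightarrow> nat list list" where
  "em_words p L =
    (if finite L \<and> L \<noteq> {} then
       let r = Max (fst ` L); s = Max (L `` {r}); j = diag_moves p (r, s)
       in map (\<lambda>i. r - i) [0..<Suc j] # em_words p (L - {(r - i, s - i) |i. i \<le> j})
     else [])"
  by pat_completeness auto
termination
proof (relation "measure (card \<circ> snd)", goal_cases)
  case 1
  show ?case by simp
next
  case (2 p L r s j)
  from 2 have fin: "finite L" and "L \<noteq> {}" by auto
  then have "r \<in> fst ` L" using 2 by simp
  then have ne: "L `` {r} \<noteq> {}" by force
  have "finite (L `` {r})" using fin by (rule finite_Image)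
  then have "s \<in> L `` {r}" using ne 2 Max_in by blast
  then have "(r, s) \<in> L" by simp
  moreover have "(r, s) \<in> {(r - i, s - i) |i. i \<le> j}" by force
  ultimately have "L - {(r - i, s - i) |i. i \<le> j} \<subset> L" by blast
  then show ?case using fin by (simp add: psubset_card_mono)
qed

declare em_words.simps [simp del]

text \<open>Permutations of \<open>{1..m}\<close> are functions that permute \<open>{1..m}\<close>; the entry in position \<open>i\<close> of the
  one-line notation of \<open>\<pi>\<close> is \<open>\<pi> i\<close>, so exchanging entries is composition on the right.\<close>

definition exchange :: "nat \<Rightarrow> (nat \<Rightarrow> nat) \<Rightarrow> nat \<Rightarrow> nat" where
  "exchange i \<pi> = \<pi> \<circ> transpose i (i + 1)"

definition decreasing_perm :: "nat \<Rightarrow> nat \<Rightarrow> nat" where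
  "decreasing_perm m i = (if i \<in> {1..m} then m + 1 - i else i)"

text \<open>Within a word the rightmost letter acts first (\<open>foldr\<close>); among the words,
  \<open>\<sigma>\<^sub>1\<close> acts first (\<open>fold\<close>).\<close>

definition egge_mansour :: "nat \<Rightarrow> step list \<Rightarrow> nat \<Rightarrow> nat" where
  "egge_mansour n p =
     fold (foldr exchange) (em_words p (labeled_squares n p)) (decreasing_perm (n + 1))"

definition involution_on :: "nat \<Rightarrow> (nat \<Rightarrow> nat) \<Rightarrow> bool" where
  "involution_on m \<pi> \<longleftrightarrow> \<pi> permutes {1..m} \<and> \<pi> = inv \<pi>"

end

theory Submission
  imports Defs
begin

text \<open>
  Write \<open>w\<^sub>m\<close> for the decreasing permutation of \<open>{1..m}\<close>. The theorem follows from two facts about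
  the Egge--Mansour map \<open>\<phi>\<close>: reversing a path inverts its permutation, and \<open>\<phi>\<close> is injective.
  Indeed \<open>\<phi>(p)\<close> is then an involution iff \<open>\<phi>(rev p) = \<phi>(p)\<close>, that is, iff \<open>rev p = p\<close>.

  Both facts become short inductions once \<open>\<phi>\<close> is written recursively. The square in which one of
  the products \<open>\<sigma>\<close> begins is the one just below an east step, and the diagonal walk from it to the
  lower left leaves the region under the path through the north step that matches this east step
  when north and east steps are read as parentheses and diagonal steps are ignored. So \<open>\<sigma>\<close>
  corresponds to one matched pair of steps, and it acts as a cycle on an interval of positions.
  Since the matched pairs are visited from right to left, every Schroeder path splits at its end as
  \<open>p d\<close> or \<open>p n q e\<close>, which gives the trees used below, and \<open>\<phi>(p) = w\<^sub>n\<^sub>+\<^sub>1 \<circ> perm p\<close> where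
  \<open>perm (p d) = perm p\<close> and \<open>perm (p n q e) = cycle \<circ> shift (perm q) \<circ> perm p\<close> (lemma \<open>egge_mansour_path\<close>, whose inductive
  core is \<open>em_words_under\<close>).

  For injectivity (\<open>perm_inject\<close>), the last value of \<open>perm (p n q e)\<close> reveals the length of \<open>p\<close>.
  Removing the cycle leaves the permutation of the concatenation \<open>p q\<close>, which is shorter, and the known
  length tells where to cut it.

  For reversal (\<open>inverse_pair_mirror\<close>), concatenating paths multiplies permutations acting on
  overlapping blocks of positions, and conjugation with the decreasing permutation exchanges the
  two ends. A pair of steps around \<open>q\<close> contributes a cycle \<open>c\<close> with \<open>w\<^sub>m\<^sub>+\<^sub>1 \<circ> c = w\<^sub>m\<close> and
  \<open>c \<circ> w\<^sub>m = w\<^sub>m\<^sub>+\<^sub>1\<close>, so it is compatible with inversion.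
\<close>

section \<open>Schroeder paths as trees\<close>

text \<open>\<open>Arch a b\<close> stands for the path \<open>a n b e\<close>: it records the pair formed by the last step and
  the north step matching it. Decomposing at the end, and not at the first return, follows the
  order in which the Egge--Mansour procedure meets the east steps.\<close>

datatype tree = Empty | Flat tree | Arch tree tree

primrec path :: "tree \<Rightarrow> step list" where
  "path Empty = []"
| "path (Flat t) = path t @ [Diag]"
| "path (Arch a b) = path a @ North # path b @ [East]"

primrec span :: "tree \<Rightarrow> nat" where
  "span Empty = 0"
| "span (Flat t) = Suc (span t)"
| "span (Arch a b) = Suc (span a + span b)"

primrec graft :: "tree \<Rightarrow> tree \<Rightarrow> tree" where
  "graft t Empty = t"
| "graft t (Flat s) = Flat (graft t s)"
| "graft t (Arch a b) = Arch (graft t a) b"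

primrec mirror :: "tree \<Rightarrow> tree" where
  "mirror Empty = Empty"
| "mirror (Flat t) = graft (Flat Empty) (mirror t)"
| "mirror (Arch a b) = graft (Arch Empty (mirror b)) (mirror a)"

lemma path_graft: "path (graft t s) = path t @ path s"
  by (induction s) auto

lemma span_graft: "span (graft t s) = span t + span s"
  by (induction s) auto

lemma span_mirror: "span (mirror t) = span t"
  by (induction t) (auto simp: span_graft)

lemma path_mirror: "path (mirror t) = path_rev (path t)"
  by (induction t) (auto simp: path_graft path_rev_def)

text \<open>A concatenation of two paths determines both factors as soon as the length of the first one
  is known: this is the cut that injectivity needs.\<close>

lemma graft_eq_iff:
  assumes "graft a b = graft a' b'" "span a = span a'"
  shows "a = a' \<and> b = b'"
  using assms
proof (induction b arbitrary: b')
  case Empty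
  then show ?case
    by (cases b') (auto simp: span_graft dest!: arg_cong[where f = span])
next
  case (Flat b)
  then show ?case
    by (cases b') (auto simp: span_graft dest!: arg_cong[where f = span])
next
  case (Arch b c)
  then show ?case
    by (cases b') (auto simp: span_graft dest!: arg_cong[where f = span])
qed

lemma endpoint_Nil [simp]: "endpoint [] = (0, 0)"
  by (simp add: endpoint_def)

lemma endpoint_append:
  "endpoint (p @ q) = (fst (endpoint p) + fst (endpoint q), snd (endpoint p) + snd (endpoint q))"
  by (simp add: endpoint_def)

lemma endpoint_Cons:
  "endpoint (s # q) = (fst (step_vec s) + fst (endpoint q), snd (step_vec s) + snd (endpoint q))"
  by (simp add: endpoint_def)

lemma endpoint_path [simp]: "endpoint (path t) = (span t, span t)"
  by (induction t) (auto simp: endpoint_append endpoint_Cons)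

text \<open>Subpaths of a fixed path have to be followed from where they start, so vertex sets are
  translated to an arbitrary starting point.\<close>

definition vertices_from :: "nat \<Rightarrow> nat \<Rightarrow> step list \<Rightarrow> (nat \<times> nat) set" where
  "vertices_from x y p = (\<lambda>(i, h). (x + i, y + h)) ` vertices p"

lemma vertices_Nil: "vertices [] = {(0, 0)}"
  by (auto simp: vertices_def)

lemma vertices_Cons:
  "vertices (s # p) = insert (0, 0) ((\<lambda>(i, h). (fst (step_vec s) + i, snd (step_vec s) + h)) ` vertices p)"
  (is "?L = ?R")
proof
  show "?L \<subseteq> ?R"
  proof
    fix v assume "v \<in> ?L"
    then obtain k where k: "k \<le> Suc (length p)" "v = endpoint (take k (s # p))"
      by (auto simp: vertices_def)
    show "v \<in> ?R"
    proof (cases k)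
      case 0
      then show ?thesis using k by simp
    next
      case (Suc l)
      then have "endpoint (take l p) \<in> vertices p" using k by (auto simp: vertices_def)
      then show ?thesis using k Suc by (force simp: endpoint_Cons)
    qed
  qed
  show "?R \<subseteq> ?L"
  proof
    fix v assume "v \<in> ?R"
    then consider "v = (0, 0)" | l where "l \<le> length p"
      "v = (fst (step_vec s) + fst (endpoint (take l p)), snd (step_vec s) + snd (endpoint (take l p)))"
      by (auto simp: vertices_def) (metis fst_conv snd_conv)
    then show "v \<in> ?L"
    proof cases
      case 1
      then show ?thesis by (auto simp: vertices_def intro!: exI[of _ 0])
    next
      case 2
      then show ?thesis
        by (auto simp: vertices_def endpoint_Cons intro!: exI[of _ "Suc l"])
    qed
  qed
qed

lemma vertices_from_Nil [simp]: "vertices_from x y [] = {(x, y)}"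
  by (simp add: vertices_from_def vertices_Nil)

lemma vertices_from_Cons [simp]:
  "vertices_from x y (s # p) =
     insert (x, y) (vertices_from (x + fst (step_vec s)) (y + snd (step_vec s)) p)"
  by (force simp: vertices_from_def vertices_Cons image_iff)

lemma start_in_vertices_from: "(x, y) \<in> vertices_from x y p"
  by (cases p) auto

lemma end_in_vertices_from:
  "(x + fst (endpoint p), y + snd (endpoint p)) \<in> vertices_from x y p"
proof (induction p arbitrary: x y)
  case (Cons s p)
  show ?case
    using Cons.IH[of "x + fst (step_vec s)" "y + snd (step_vec s)"]
    by (simp add: endpoint_Cons add.assoc)
qed simp

lemma vertices_from_append:
  "vertices_from x y (p @ q) =
     vertices_from x y p \<union> vertices_from (x + fst (endpoint p)) (y + snd (endpoint p)) q"
proof (induction p arbitrary: x y)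
  case Nil
  then show ?case using start_in_vertices_from by auto
next
  case (Cons s p)
  then show ?case by (simp add: endpoint_Cons add.assoc)
qed

lemma vertices_from_bounds:
  "(i, h) \<in> vertices_from x y p \<Longrightarrow>
     x \<le> i \<and> i \<le> x + fst (endpoint p) \<and> y \<le> h \<and> h \<le> y + snd (endpoint p)"
proof (induction p arbitrary: x y)
  case Nil
  then show ?case by simp
next
  case (Cons s p)
  show ?case using Cons.prems Cons.IH by (fastforce simp: endpoint_Cons)
qed

lemma vertices_eq: "vertices p = vertices_from 0 0 p"
  by (simp add: vertices_from_def)

lemma path_above_diagonal:
  "(i, h) \<in> vertices_from x y (path t) \<Longrightarrow> i + y \<le> h + x"
  by (induction t arbitrary: x y) (fastforce simp: vertices_from_append)+

text \<open>No step advances by more than one column, so a path has a vertex over every abscissa of its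
  range, and that vertex is weakly above the diagonal through the starting point. This is what
  puts a whole diagonal under the path.\<close>

lemma path_meets_abscissa:
  assumes "i \<le> span t"
  shows "\<exists>h \<ge> y + i. (x + i, h) \<in> vertices_from x y (path t)"
  using assms
proof (induction t arbitrary: x y i)
  case Empty
  then show ?case by simp
next
  case (Flat t)
  show ?case
  proof (cases "i \<le> span t")
    case True
    then show ?thesis using Flat.IH[of i y x] by (auto simp: vertices_from_append)
  next
    case False
    then have "i = Suc (span t)" using Flat.prems by simp
    then show ?thesis by (auto simp: vertices_from_append)
  qed
next
  case (Arch a b)
  consider "i \<le> span a" | j where "i = span a + j" "j \<le> span b" | "i = Suc (span a + span b)"
    using Arch.prems by (metis add_le_cancel_left le_Suc_eq le_add_diff_inverse nat_le_linear span.simps(3))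
  then show ?case
  proof cases
    case 1
    then show ?thesis using Arch.IH(1)[of i y x] by (auto simp: vertices_from_append)
  next
    case 2
    then show ?thesis using Arch.IH(2)[of j "y + span a + 1" "x + span a"]
      by (auto simp: vertices_from_append add.assoc) (metis Suc_leD add_Suc_right)
  next
    case 3
    then show ?thesis by (auto simp: vertices_from_append)
  qed
qed

text \<open>Reading a prefix of a Schroeder path with a stack: \<open>ts\<close> lists the completed pieces that
  precede the north steps not yet matched, and \<open>t\<close> is the piece being built. An east step closes
  the innermost open north step, which exists because the prefix stays weakly above the diagonal.\<close>

lemma prefix_parse:
  assumes "\<forall>(i, h) \<in> vertices p. i \<le> h"
  shows "\<exists>ts t. p = concat (map (\<lambda>t. path t @ [North]) ts) @ path t \<and>
           snd (endpoint p) = fst (endpoint p) + length ts"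
  using assms
proof (induction p rule: rev_induct)
  case Nil
  have "path Empty = []" by simp
  then show ?case by (metis append_Nil concat.simps(1) endpoint_Nil fst_conv snd_conv add_0 list.map(1) list.size(3))
next
  case (snoc s p)
  have "\<forall>(i, h) \<in> vertices p. i \<le> h"
    using snoc.prems by (auto simp: vertices_eq vertices_from_append)
  then obtain ts t where p: "p = concat (map (\<lambda>t. path t @ [North]) ts) @ path t"
    and len: "snd (endpoint p) = fst (endpoint p) + length ts"
    using snoc.IH by blast
  show ?case
  proof (cases s)
    case North
    then show ?thesis using p len
      by (intro exI[of _ "ts @ [t]"] exI[of _ Empty]) (simp add: endpoint_append endpoint_Cons)
  next
    case Diag
    then show ?thesis using p len
      by (intro exI[of _ ts] exI[of _ "Flat t"]) (simp add: endpoint_append endpoint_Cons)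
  next
    case East
    have "fst (endpoint p) + 1 \<le> snd (endpoint p)"
      using snoc.prems East by (simp add: vertices_eq vertices_from_append)
    then obtain ts' t' where "ts = ts' @ [t']" using len
      by (cases ts rule: rev_cases) auto
    then show ?thesis using p len East
      by (intro exI[of _ ts'] exI[of _ "Arch t' t"]) (simp add: endpoint_append endpoint_Cons)
  qed
qed

lemma schroeder_path_tree:
  assumes "p \<in> schroeder_paths n"
  obtains t where "p = path t" "span t = n"
proof -
  have p: "endpoint p = (n, n)" "\<forall>(i, h) \<in> vertices p. i \<le> h"
    using assms by (auto simp: schroeder_paths_def)
  from prefix_parse[OF p(2)] obtain t where "p = path t" using p(1) by auto
  then show ?thesis using p(1) that by simp
qed

section \<open>The permutation read off a tree\<close>

text \<open>For \<open>u\<close> permuting \<open>{1..m}\<close> this is \<open>u\<close> moved to the positions \<open>{k + 1..k + m}\<close>. The position \<open>k\<close>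
  is sent to \<open>u 0 + k = k\<close>; treating it with the moved positions makes \<open>shift k\<close> compatible with
  composition for arbitrary \<open>u\<close>.\<close>

definition shift :: "nat \<Rightarrow> (nat \<Rightarrow> nat) \<Rightarrow> nat \<Rightarrow> nat" where
  "shift k u i = (if i < k then i else u (i - k) + k)"

text \<open>The product \<open>s\<^sub>a s\<^sub>a\<^sub>+\<^sub>1 \<dots> s\<^sub>b\<^sub>-\<^sub>1\<close> of adjacent transpositions, composed as functions.\<close>

definition cyc :: "nat \<Rightarrow> nat \<Rightarrow> nat \<Rightarrow> nat" where
  "cyc a b i = (if i = b then a else if a \<le> i \<and> i < b then Suc i else i)"

text \<open>The east step that closes \<open>Arch a b\<close> contributes the cycle, which is outermost because this step
  is met first; its lower end is determined by the column in which the matching north step lies.\<close>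

fun perm :: "tree \<Rightarrow> nat \<Rightarrow> nat" where
  "perm Empty = id"
| "perm (Flat t) = perm t"
| "perm (Arch a b) =
     cyc (Suc (span a)) (span a + span b + 2) \<circ> shift (span a) (perm b) \<circ> perm a"

lemma shift_comp: "shift k (u \<circ> v) = shift k u \<circ> shift k v"
  by (auto simp: shift_def fun_eq_iff)

lemma shift_shift: "shift j (shift k u) = shift (j + k) u"
  by (auto simp: shift_def fun_eq_iff)

lemma shift_id [simp]: "shift k id = id"
  by (auto simp: shift_def fun_eq_iff)

lemma shift_cyc: "shift k (cyc a b) = cyc (k + a) (k + b)"
  by (auto simp: shift_def cyc_def fun_eq_iff)

lemma shift_permutes:
  assumes "u permutes {1..m}"
  shows "shift k u permutes {k + 1..k + m}"
proof (rule bij_imp_permutes)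
  have "inj_on (shift k u) {k + 1..k + m}"
    by (rule inj_onI) (use permutes_inj[OF assms] in \<open>auto simp: shift_def dest!: injD\<close>)
  moreover have "shift k u ` {k + 1..k + m} \<subseteq> {k + 1..k + m}"
    using permutes_in_image[OF assms] by (fastforce simp: shift_def)
  ultimately show "bij_betw (shift k u) {k + 1..k + m} {k + 1..k + m}"
    by (simp add: bij_betw_def endo_inj_surj)
next
  fix i assume "i \<notin> {k + 1..k + m}"
  show "shift k u i = i"
  proof (cases "i < k")
    case False
    then have "i - k \<notin> {1..m}" using \<open>i \<notin> {k + 1..k + m}\<close> by auto
    then have "u (i - k) = i - k" by (rule permutes_not_in[OF assms])
    then show ?thesis using False by (simp add: shift_def)
  qed (simp add: shift_def)
qed

lemma cyc_permutes:
  assumes "a \<le> b"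
  shows "cyc a b permutes {a..b}"
proof (rule bij_imp_permutes)
  have "inj_on (cyc a b) {a..b}"
    by (auto simp: inj_on_def cyc_def)
  moreover have "cyc a b ` {a..b} \<subseteq> {a..b}"
    using assms by (auto simp: cyc_def)
  ultimately show "bij_betw (cyc a b) {a..b} {a..b}"
    by (simp add: bij_betw_def endo_inj_surj)
qed (use assms in \<open>auto simp: cyc_def\<close>)

lemma perm_permutes: "perm t permutes {1..Suc (span t)}"
proof (induction t)
  case Empty
  show ?case by (simp only: perm.simps permutes_id)
next
  case (Flat t)
  then show ?case by (auto intro: permutes_subset)
next
  case (Arch a b)
  let ?S = "{1..Suc (span (Arch a b))}"
  have "perm a permutes ?S"
    using Arch.IH(1) by (rule permutes_subset) auto
  moreover have "shift (span a) (perm b) permutes ?S"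
    using shift_permutes[OF Arch.IH(2)] by (rule permutes_subset) auto
  moreover have "cyc (Suc (span a)) (span a + span b + 2) permutes ?S"
    by (rule permutes_subset[OF cyc_permutes]) auto
  ultimately show ?case by (simp only: perm.simps permutes_compose)
qed

text \<open>Concatenation is defined by recursion on the second path, along which the cycles accumulate
  on the left; shifting moves them past the columns of the first path.\<close>

lemma perm_graft: "perm (graft t s) = shift (span t) (perm s) \<circ> perm t"
  by (induction s)
    (simp_all only: graft.simps perm.simps shift_id id_comp shift_comp shift_shift shift_cyc
      span_graft comp_assoc add.assoc add_Suc_right)

lemma perm_Arch_graft:
  "perm (Arch a b) = cyc (Suc (span a)) (span a + span b + 2) \<circ> perm (graft a b)"
  by (simp only: perm.simps perm_graft comp_assoc)

lemma perm_fixes_above: "span t + 1 < i \<Longrightarrow> perm t i = i"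
  using permutes_not_in[OF perm_permutes, of i t] by simp

text \<open>Everything under the cycle fixes the last position, so the value there is the start of the
  cycle: it locates the north step matching a final east step.\<close>

lemma perm_Arch_last: "perm (Arch a b) (span a + span b + 2) = Suc (span a)"
proof -
  have "perm (graft a b) (span a + span b + 2) = span a + span b + 2"
    by (rule perm_fixes_above) (simp add: span_graft)
  then show ?thesis by (simp only: perm_Arch_graft comp_apply) (simp add: cyc_def)
qed

text \<open>The value at the last position separates \<open>Flat\<close>, which fixes it, from \<open>Arch a b\<close>, and it
  gives the length of \<open>a\<close>. Cancelling the cycle leaves the permutation of \<open>graft a b\<close>, to which the
  induction hypothesis applies although \<open>graft a b\<close> is not a subtree: the induction is on the
  length.\<close>

lemma perm_inject:
  assumes "perm t = perm t'" "span t = span t'"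
  shows "t = t'"
  using assms
proof (induction "span t" arbitrary: t t')
  case 0
  then show ?case by (cases t; cases t') auto
next
  case (Suc n)
  have last: "perm t (Suc (Suc n)) = perm t' (Suc (Suc n))" using Suc.prems by simp
  show ?case
  proof (cases t)
    case Empty
    then show ?thesis using Suc.hyps by simp
  next
    case t: (Flat s)
    then have fix_last: "perm t (Suc (Suc n)) = Suc (Suc n)"
      using Suc.hyps by (simp add: perm_fixes_above)
    show ?thesis
    proof (cases t')
      case Empty
      then show ?thesis using Suc by simp
    next
      case (Flat s')
      then show ?thesis using t Suc by auto
    next
      case (Arch a' b')
      then show ?thesis using perm_Arch_last[of a' b'] last fix_last Suc by simp
    qed
  next
    case t: (Arch a b)
    then have val: "perm t (Suc (Suc n)) = Suc (span a)" and "span a \<le> n"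
      using perm_Arch_last[of a b] Suc.hyps by simp_all
    show ?thesis
    proof (cases t')
      case Empty
      then show ?thesis using Suc by simp
    next
      case (Flat s')
      then have "perm t' (Suc (Suc n)) = Suc (Suc n)"
        using Suc by (simp add: perm_fixes_above)
      then show ?thesis using val \<open>span a \<le> n\<close> last by simp
    next
      case t': (Arch a' b')
      have a: "span a = span a'"
        using perm_Arch_last[of a' b'] t' val last Suc by simp
      then have b: "span b = span b'" using Suc t t' by simp
      have inj: "inj (cyc (Suc (span a)) (span a + span b + 2))"
        by (rule permutes_inj[OF cyc_permutes]) simp
      have "perm (graft a b) = perm (graft a' b')"
      proof
        fix i
        have "perm (Arch a b) i = perm (Arch a' b') i"
          using Suc.prems(1) t t' by simp
        then show "perm (graft a b) i = perm (graft a' b') i"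
          using inj a b by (simp only: perm_Arch_graft comp_apply) (blast dest: injD)
      qed
      then have "graft a b = graft a' b'"
        using Suc t a b by (intro Suc.hyps(1)) (auto simp: span_graft)
      then show ?thesis using graft_eq_iff a t t' by blast
    qed
  qed
qed

section \<open>Reversal and inversion\<close>

lemma decreasing_perm_involutive: "decreasing_perm m \<circ> decreasing_perm m = id"
  by (auto simp: decreasing_perm_def fun_eq_iff)

lemma decreasing_perm_decreasing_perm [simp]:
  "decreasing_perm m (decreasing_perm m i) = i"
  by (auto simp: decreasing_perm_def)

lemma decreasing_perm_permutes: "decreasing_perm m permutes {1..m}"
  by (rule bij_imp_permutes, rule bij_betw_byWitness[where f' = "decreasing_perm m"])
    (auto simp: decreasing_perm_def)

text \<open>Conjugating with the decreasing permutation of all \<open>k + m + 1\<close> positions moves a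
  permutation of the last \<open>m + 1\<close> positions to the first \<open>m + 1\<close> positions, where the result is the
  conjugate with the smaller decreasing permutation.\<close>

lemma decreasing_perm_shift:
  assumes "u permutes {1..Suc m}"
  shows "decreasing_perm (Suc (k + m)) \<circ> shift k u =
    decreasing_perm (Suc m) \<circ> u \<circ> decreasing_perm (Suc m) \<circ> decreasing_perm (Suc (k + m))"
proof
  fix i
  have out: "j \<notin> {1..Suc m} \<Longrightarrow> u j = j" for j
    using permutes_not_in[OF assms] .
  have im: "u j \<in> {1..Suc m}" if "j \<in> {1..Suc m}" for j
    using permutes_in_image[OF assms] that by blast
  consider "i \<le> k" | j where "i = k + j" "j \<in> {1..Suc m}" | "Suc (k + m) < i"
  proof -
    have "i = k + (i - k)" "i - k \<in> {1..Suc m}" if "k < i" "i \<le> Suc (k + m)"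
      using that by auto
    then show thesis using that by (meson not_le)
  qed
  then show "(decreasing_perm (Suc (k + m)) \<circ> shift k u) i =
    (decreasing_perm (Suc m) \<circ> u \<circ> decreasing_perm (Suc m) \<circ> decreasing_perm (Suc (k + m))) i"
  proof cases
    case 1
    then show ?thesis using out[of 0] out[of "Suc (k + m) + 1 - i"]
      by (cases "i = 0") (auto simp: shift_def decreasing_perm_def)
  next
    case 2
    then show ?thesis using im[of j] by (auto simp: shift_def decreasing_perm_def)
  next
    case 3
    then have "i - k \<notin> {1..Suc m}" "i \<notin> {1..Suc m}" by auto
    then show ?thesis using 3 out[of "i - k"] out[of i]
      by (auto simp: shift_def decreasing_perm_def)
  qed
qed

text \<open>With \<open>w\<close> the decreasing permutation, this says that \<open>w \<circ> perm t\<close> and \<open>w \<circ> perm t'\<close> are inverse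
  to each other, written as \<open>perm t' \<circ> w \<circ> perm t = w\<close> so that no inverse occurs.\<close>

definition inverse_pair :: "tree \<Rightarrow> tree \<Rightarrow> bool" where
  "inverse_pair t t' \<longleftrightarrow> span t' = span t \<and>
     (\<forall>i. perm t' (decreasing_perm (Suc (span t)) (perm t i)) = decreasing_perm (Suc (span t)) i)"

text \<open>Pushing the decreasing permutation through the two shifted factors turns the long product
  into the relation for \<open>c\<close> and \<open>c'\<close>, which collapses to a decreasing permutation, followed by the one
  for \<open>a\<close> and \<open>a'\<close>.\<close>

lemma inverse_pair_graft:
  assumes ab: "inverse_pair a a'" and cd: "inverse_pair c c'"
  shows "inverse_pair (graft a c) (graft c' a')"
proof -
  have sp: "span a' = span a" "span c' = span c"
    using assms by (simp_all add: inverse_pair_def)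
  let ?w = "decreasing_perm (Suc (span a + span c))"
  \<comment> \<open>Each shifted factor becomes unshifted when it crosses the large decreasing permutation.\<close>
  have c: "?w (shift (span a) (perm c) i) =
      decreasing_perm (Suc (span c)) (perm c (decreasing_perm (Suc (span c)) (?w i)))" for i
    using decreasing_perm_shift[OF perm_permutes[of c], of "span a"] by (simp add: fun_eq_iff)
  have "?w (shift (span c) (perm a') i) =
      decreasing_perm (Suc (span a)) (perm a' (decreasing_perm (Suc (span a)) (?w i)))" for i
    using decreasing_perm_shift[OF perm_permutes[of a'], of "span c"] sp
    by (simp add: fun_eq_iff add.commute)
  then have a': "shift (span c) (perm a') (?w i) =
      ?w (decreasing_perm (Suc (span a)) (perm a' (decreasing_perm (Suc (span a)) i)))" for i
    by (metis decreasing_perm_decreasing_perm)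
  show ?thesis
    using ab cd sp unfolding inverse_pair_def
    by (simp add: perm_graft span_graft c a')
qed

text \<open>The cycle on \<open>{1..m + 1}\<close> is the product of the decreasing permutations of \<open>{1..m + 1}\<close> and
  \<open>{1..m}\<close>. Hence the two cycles of the surrounding pairs of steps shrink the decreasing permutation
  on one side and enlarge it again on the other.\<close>

lemma inverse_pair_Arch:
  assumes "inverse_pair b b'"
  shows "inverse_pair (Arch Empty b) (Arch Empty b')"
proof -
  have sp: "span b' = span b" using assms by (simp add: inverse_pair_def)
  have 1: "decreasing_perm (span b + 2) (cyc 1 (span b + 2) i) = decreasing_perm (Suc (span b)) i" for i
    by (auto simp: decreasing_perm_def cyc_def)
  have 2: "cyc 1 (span b + 2) (decreasing_perm (Suc (span b)) i) = decreasing_perm (span b + 2) i" for i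
    by (auto simp: decreasing_perm_def cyc_def)
  have sh: "shift 0 u = u" for u :: "nat \<Rightarrow> nat" by (auto simp: shift_def)
  show ?thesis using assms sp 1 2 unfolding inverse_pair_def
    by (simp add: sh numeral_2_eq_2)
qed

text \<open>Both \<open>Flat t\<close> and \<open>Arch a b\<close> are concatenations of their first part with \<open>d\<close> or with
  \<open>n b e\<close>, so the two preceding lemmas cover every case.\<close>

lemma inverse_pair_mirror: "inverse_pair t (mirror t)"
proof (induction t)
  case Empty
  then show ?case by (simp add: inverse_pair_def)
next
  case (Flat t)
  have "inverse_pair (Flat Empty) (Flat Empty)" by (simp add: inverse_pair_def)
  from inverse_pair_graft[OF Flat.IH this] show ?case by simp
next
  case (Arch a b)
  from inverse_pair_graft[OF Arch.IH(1) inverse_pair_Arch[OF Arch.IH(2)]] show ?case by simp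
qed

section \<open>Labeled squares under a path\<close>

text \<open>The squares whose top-left corner lies strictly above the diagonal through the starting
  point \<open>(x, y)\<close> and on or below the path. For a subpath \<open>b\<close> enclosed by a matched pair, this diagonal lies one unit higher than that
  of the whole arch.\<close>

definition squares_under :: "nat \<Rightarrow> nat \<Rightarrow> step list \<Rightarrow> (nat \<times> nat) set" where
  "squares_under x y q =
     {(Suc i, s) |i s. Suc i + y \<le> s + x \<and> (\<exists>h \<ge> s. (i, h) \<in> vertices_from x y q)}"

text \<open>The squares whose labels are removed in one round of the procedure.\<close>

definition ray :: "nat \<Rightarrow> nat \<Rightarrow> nat \<Rightarrow> (nat \<times> nat) set" where
  "ray r s j = {(r - i, s - i) |i. i \<le> j}"

lemma labeled_squares_path:
  "labeled_squares (span t) (path t) = squares_under 0 0 (path t)"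
proof -
  have bound: "i \<le> span t \<and> h \<le> span t" if "(i, h) \<in> vertices_from 0 0 (path t)" for i h
    using vertices_from_bounds[OF that] by simp
  have "(r, s) \<in> labeled_squares (span t) (path t) \<longleftrightarrow> (r, s) \<in> squares_under 0 0 (path t)" for r s
  proof (cases r)
    case 0
    then show ?thesis by (simp add: labeled_squares_def squares_under_def)
  next
    case (Suc i)
    show ?thesis
    proof
      assume "(r, s) \<in> labeled_squares (span t) (path t)"
      then show "(r, s) \<in> squares_under 0 0 (path t)"
        using Suc by (auto simp: labeled_squares_def squares_under_def on_or_below_def vertices_eq)
    next
      assume "(r, s) \<in> squares_under 0 0 (path t)"
      then obtain h where h: "Suc i \<le> s" "s \<le> h" "(i, h) \<in> vertices_from 0 0 (path t)"
        using Suc by (auto simp: squares_under_def)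
      then show "(r, s) \<in> labeled_squares (span t) (path t)"
        using Suc bound[OF h(3)] by (auto simp: labeled_squares_def on_or_below_def vertices_eq)
    qed
  qed
  then show ?thesis by auto
qed

lemma finite_squares_under: "finite (squares_under x y q)"
proof (rule finite_subset)
  let ?n = "x + fst (endpoint q) + y + snd (endpoint q)"
  show "squares_under x y q \<subseteq> {..Suc ?n} \<times> {..?n}"
    by (auto simp: squares_under_def dest!: vertices_from_bounds)
qed simp

lemma squares_under_path_bounds:
  assumes "(r, s) \<in> squares_under x y (path t)"
  shows "x < r" "r \<le> x + span t" "r + y \<le> s + x"
  using assms by (auto simp: squares_under_def dest!: vertices_from_bounds)

lemma squares_under_Empty: "squares_under x y (path Empty) = {}"
  by (auto simp: squares_under_def)

lemma squares_under_Flat: "squares_under x y (path (Flat t)) = squares_under x y (path t)"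
  using end_in_vertices_from[of x "path t" y]
  by (auto simp: squares_under_def vertices_from_append)

lemma ray_eq:
  "ray (Suc (x + m)) (Suc (y + m)) m = {(Suc (x + k), Suc (y + k)) |k. k \<le> m}"
  (is "_ = ?R")
proof (intro equalityI subsetI)
  fix c assume "c \<in> ray (Suc (x + m)) (Suc (y + m)) m"
  then obtain i where "i \<le> m" "c = (Suc (x + m) - i, Suc (y + m) - i)"
    by (auto simp: ray_def)
  then show "c \<in> ?R" by (intro CollectI exI[of _ "m - i"]) (simp add: Suc_diff_le)
next
  fix c assume "c \<in> ?R"
  then obtain k where "k \<le> m" "c = (Suc (x + k), Suc (y + k))" by blast
  then show "c \<in> ray (Suc (x + m)) (Suc (y + m)) m"
    unfolding ray_def by (intro CollectI exI[of _ "m - k"]) simp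
qed

text \<open>Under \<open>a n b e\<close> lie the squares under \<open>a\<close>, those under \<open>b\<close>, and the part of the lowest diagonal
  between the final north and east steps of the pair. The end of the arch adds nothing
  else: it lies on the diagonal, so a square to its right with top-left corner above the diagonal is
  not below the path.\<close>

lemma squares_under_Arch:
  "squares_under x y (path (Arch a b)) =
     ray (Suc (x + span a + span b)) (Suc (y + span a + span b)) (span b) \<union>
     (squares_under (x + span a) (Suc (y + span a)) (path b) \<union> squares_under x y (path a))"
  (is "?L = ?R")
proof
  show "?L \<subseteq> ?R"
  proof
    fix c assume "c \<in> ?L"
    then obtain i s h where c: "c = (Suc i, s)" and d: "Suc i + y \<le> s + x" and h: "s \<le> h"
      and v: "(i, h) \<in> vertices_from x y (path (Arch a b))"
      by (auto simp: squares_under_def)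
    from v consider "(i, h) \<in> vertices_from x y (path a)"
      | "(i, h) \<in> vertices_from (x + span a) (Suc (y + span a)) (path b)"
      | "i = Suc (x + span a + span b)" "h = Suc (y + span a + span b)"
      using end_in_vertices_from[of x "path a" y]
        end_in_vertices_from[of "x + span a" "path b" "Suc (y + span a)"]
      by (auto simp: vertices_from_append)
    then show "c \<in> ?R"
    proof cases
      case 1
      then show ?thesis using c d h by (auto simp: squares_under_def)
    next
      case 2
      show ?thesis
      proof (cases "Suc i + Suc (y + span a) \<le> s + (x + span a)")
        case True
        then show ?thesis using 2 c h by (auto simp: squares_under_def)
      next
        case False
        have "i = x + span a + (i - (x + span a))" "i - (x + span a) \<le> span b"
          using vertices_from_bounds[OF 2] by auto
        then obtain k where "i = x + span a + k" "k \<le> span b" by blast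
        moreover have "s = Suc (y + span a + k)"
          using False d calculation(1) by simp
        ultimately show ?thesis using c by (auto simp: ray_eq)
      qed
    next
      case 3
      then show ?thesis using d h by simp
    qed
  qed
  show "?R \<subseteq> ?L"
  proof
    fix c assume "c \<in> ?R"
    then consider "c \<in> squares_under x y (path a)"
      | "c \<in> squares_under (x + span a) (Suc (y + span a)) (path b)"
      | k where "c = (Suc (x + span a + k), Suc (y + span a + k))" "k \<le> span b"
      by (auto simp: ray_eq)
    then show "c \<in> ?L"
    proof cases
      case 1
      then show ?thesis by (auto simp: squares_under_def vertices_from_append)
    next
      case 2
      then show ?thesis by (fastforce simp: squares_under_def vertices_from_append)
    next
      case 3
      then obtain h where "h \<ge> Suc (y + span a) + k"
        "(x + span a + k, h) \<in> vertices_from (x + span a) (Suc (y + span a)) (path b)"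
        using path_meets_abscissa by blast
      then show ?thesis using 3 by (auto simp: squares_under_def vertices_from_append)
    qed
  qed
qed

lemma left_side_is_north_vertex:
  "left_side_is_north p (Suc i, Suc h) \<Longrightarrow> (i, h) \<in> vertices p"
  by (auto simp: left_side_is_north_def vertices_def) (metis less_imp_le)

text \<open>Between the matched north and east steps the path stays strictly above the diagonal through
  the start of the north step, while everything before and after lies to the lower left or the upper
  right. So the walk along this diagonal meets no vertex of the path, and hence no north step,
  before the matching one.\<close>

lemma diag_moves_arch:
  assumes "endpoint u = (x, y)"
  shows "diag_moves (u @ North # path b @ East # v) (Suc (x + span b), Suc (y + span b)) = span b"
    (is "diag_moves ?p _ = ?m")
proof -
  have vs: "vertices ?p = vertices_from 0 0 u \<union> vertices_from x (Suc y) (path b) \<union>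
      vertices_from (Suc (x + ?m)) (Suc (y + ?m)) v"
    using end_in_vertices_from[of 0 u 0] end_in_vertices_from[of x "path b" "Suc y"] assms
    by (auto simp: vertices_eq vertices_from_append)
  show ?thesis unfolding diag_moves_def prod.case
  proof (rule Least_equality, intro conjI)
    show "left_side_is_north ?p (Suc (x + ?m) - ?m, Suc (y + ?m) - ?m)"
      using assms by (auto simp: left_side_is_north_def intro!: exI[of _ "length u"])
  next
    fix j
    assume j: "j < Suc (x + ?m) \<and> j < Suc (y + ?m) \<and>
      left_side_is_north ?p (Suc (x + ?m) - j, Suc (y + ?m) - j)"
    show "?m \<le> j"
    proof (rule ccontr)
      assume "\<not> ?m \<le> j"
      \<comment> \<open>A north step met too early would start on the diagonal, strictly inside the arch.\<close>
      then obtain k where k: "?m = j + Suc k" using less_iff_Suc_add by (metis add_Suc_right not_le)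
      then have "(x + Suc k, y + Suc k) \<in> vertices ?p"
        using j by (intro left_side_is_north_vertex) (simp add: Suc_diff_le)
      then show False
        using vertices_from_bounds[of "x + Suc k" "y + Suc k" 0 0 u] assms k
          path_above_diagonal[of "x + Suc k" "y + Suc k" x "Suc y" b]
          vertices_from_bounds[of "x + Suc k" "y + Suc k" "Suc (x + ?m)" "Suc (y + ?m)" v]
        by (auto simp: vs)
    qed
  qed simp_all
qed

lemma em_words_step:
  assumes "finite L" "(r, s) \<in> L" "\<And>r' s'. (r', s') \<in> L \<Longrightarrow> (r', s') = (r, s) \<or> r' < r"
  shows "em_words p L = map (\<lambda>i. r - i) [0..<Suc (diag_moves p (r, s))] #
    em_words p (L - ray r s (diag_moves p (r, s)))"
proof -
  have "Max (fst ` L) = r"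
    using assms by (intro Max_eqI) force+
  moreover have "L `` {r} = {s}"
    using assms(2,3) by fastforce
  moreover have "L \<noteq> {}" using assms(2) by blast
  ultimately show ?thesis using assms(1)
    by (subst em_words.simps) (simp only: ray_def Let_def Max_singleton if_True simp_thms)
qed

lemma transpose_cyc: "a < b \<Longrightarrow> transpose a (Suc a) \<circ> cyc (Suc a) b = cyc a b"
  by (auto simp: cyc_def transpose_def fun_eq_iff)

text \<open>Exchanging entries is composition on the right and the last letter of the word acts first, so
  the transpositions appear in increasing order.\<close>

lemma foldr_exchange:
  assumes "j < r"
  shows "foldr exchange (map (\<lambda>i. r - i) [0..<Suc j]) \<pi> = \<pi> \<circ> cyc (r - j) (Suc r)"
  using assms
proof (induction j arbitrary: \<pi>)
  case 0
  have "transpose r (Suc r) = cyc r (Suc r)"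
    by (auto simp: cyc_def transpose_def fun_eq_iff)
  then show ?case by (simp add: exchange_def)
next
  case (Suc j)
  have "foldr exchange (map (\<lambda>i. r - i) [0..<Suc (Suc j)]) \<pi> =
      foldr exchange (map (\<lambda>i. r - i) [0..<Suc j]) (exchange (r - Suc j) \<pi>)"
    by simp
  also have "\<dots> = \<pi> \<circ> (transpose (r - Suc j) (Suc (r - Suc j)) \<circ> cyc (Suc (r - Suc j)) (Suc r))"
    using Suc by (subst Suc.IH) (auto simp: exchange_def comp_assoc Suc_diff_Suc)
  also have "\<dots> = \<pi> \<circ> cyc (r - Suc j) (Suc r)"
    by (subst transpose_cyc) auto
  finally show ?case .
qed

text \<open>The procedure run on a whole path \<open>u t v\<close> first clears everything under the subpath \<open>t\<close>, whatever
  labels \<open>R\<close> remain in the columns to the left, and in doing so multiplies by the shifted permutation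
  of \<open>t\<close>. Keeping \<open>R\<close> and the surrounding path general is what lets the induction hypotheses be used
  for the two parts of an arch in turn: the ray of the arch has the unique largest label and goes
  first, then the squares under \<open>b\<close>, then those under \<open>a\<close>.\<close>

lemma em_words_under:
  assumes "endpoint u = (x, y)" "finite R" "\<forall>(r, s) \<in> R. r \<le> x"
  shows "fold (foldr exchange) (em_words (u @ path t @ v) (squares_under x y (path t) \<union> R)) \<pi> =
    fold (foldr exchange) (em_words (u @ path t @ v) R) (\<pi> \<circ> shift x (perm t))"
  using assms
proof (induction t arbitrary: u x y v R \<pi>)
  case Empty
  show ?case by (simp only: squares_under_Empty perm.simps shift_id comp_id Un_empty_left)
next
  case (Flat t)
  from Flat.IH[OF Flat.prems, where v = "Diag # v"] show ?case
    unfolding squares_under_Flat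
    by (simp only: perm.simps path.simps append_assoc append_Cons append_Nil)
next
  case (Arch a b)
  let ?p = "u @ path (Arch a b) @ v"
  let ?r = "Suc (x + span a + span b)" and ?s = "Suc (y + span a + span b)"
  let ?B = "squares_under (x + span a) (Suc (y + span a)) (path b)" and ?A = "squares_under x y (path a)"
  let ?D = "ray ?r ?s (span b)"
  have L: "squares_under x y (path (Arch a b)) \<union> R = ?D \<union> (?B \<union> (?A \<union> R))"
    by (simp only: squares_under_Arch Un_assoc)
  have AR: "r \<le> x + span a" if "(r, s) \<in> ?A \<union> R" for r s
    using that Arch.prems(3) squares_under_path_bounds(2) by fastforce
  have j: "diag_moves ?p (?r, ?s) = span b"
    using diag_moves_arch[of "u @ path a" "x + span a" "y + span a" b v] Arch.prems(1)
    by (simp add: endpoint_append)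
  have "em_words ?p (?D \<union> (?B \<union> (?A \<union> R))) =
      map (\<lambda>i. ?r - i) [0..<Suc (span b)] # em_words ?p (?D \<union> (?B \<union> (?A \<union> R)) - ?D)"
  proof (subst em_words_step[of _ ?r ?s])
    show "finite (?D \<union> (?B \<union> (?A \<union> R)))"
      using Arch.prems(2) by (simp add: finite_squares_under ray_def)
    show "(?r, ?s) \<in> ?D \<union> (?B \<union> (?A \<union> R))"
      by (force simp: ray_def)
    show "(r', s') = (?r, ?s) \<or> r' < ?r" if "(r', s') \<in> ?D \<union> (?B \<union> (?A \<union> R))" for r' s'
      using that AR[of r' s'] squares_under_path_bounds(2)[of r' s' "x + span a" "Suc (y + span a)" b]
      by (auto simp: ray_eq)
  qed (simp only: j)
  also have "?D \<union> (?B \<union> (?A \<union> R)) - ?D = ?B \<union> (?A \<union> R)"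
  proof -
    have "c \<notin> ?D" if "c \<in> ?B \<union> (?A \<union> R)" for c
      using that AR[of "fst c" "snd c"]
        squares_under_path_bounds(3)[of "fst c" "snd c" "x + span a" "Suc (y + span a)" b]
      by (auto simp: ray_eq)
    then show ?thesis by blast
  qed
  finally have "fold (foldr exchange) (em_words ?p (squares_under x y (path (Arch a b)) \<union> R)) \<pi> =
      fold (foldr exchange) (em_words ?p (?B \<union> (?A \<union> R)))
        (\<pi> \<circ> cyc (x + Suc (span a)) (x + (span a + span b + 2)))"
    unfolding L by (simp add: foldr_exchange add.assoc del: upt_Suc path.simps)
  also have "\<dots> = fold (foldr exchange) (em_words ?p (?A \<union> R))
        (\<pi> \<circ> cyc (x + Suc (span a)) (x + (span a + span b + 2)) \<circ> shift (x + span a) (perm b))"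
  proof -
    have "endpoint (u @ path a @ [North]) = (x + span a, Suc (y + span a))"
      using Arch.prems(1) by (simp add: endpoint_append endpoint_Cons)
    moreover have "finite (?A \<union> R)" using Arch.prems(2) by (simp add: finite_squares_under)
    moreover have "\<forall>(r, s) \<in> ?A \<union> R. r \<le> x + span a" using AR by blast
    ultimately show ?thesis
      using Arch.IH(2)[where u = "u @ path a @ [North]" and v = "East # v"]
      by (simp only: path.simps append_assoc append_Cons append_Nil)
  qed
  also have "\<dots> = fold (foldr exchange) (em_words ?p R)
        (\<pi> \<circ> cyc (x + Suc (span a)) (x + (span a + span b + 2)) \<circ> shift (x + span a) (perm b)
          \<circ> shift x (perm a))"
    using Arch.IH(1)[OF Arch.prems, where v = "North # path b @ East # v"]
    by (simp only: path.simps append_assoc append_Cons append_Nil)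
  also have "\<pi> \<circ> cyc (x + Suc (span a)) (x + (span a + span b + 2)) \<circ> shift (x + span a) (perm b)
          \<circ> shift x (perm a) = \<pi> \<circ> shift x (perm (Arch a b))"
    by (simp only: perm.simps shift_comp shift_shift shift_cyc comp_assoc)
  finally show ?case .
qed

lemma egge_mansour_path:
  "egge_mansour (span t) (path t) = decreasing_perm (Suc (span t)) \<circ> perm t"
proof -
  have "em_words (path t) {} = []" by (subst em_words.simps) simp
  moreover have "shift 0 u = u" for u by (auto simp: shift_def)
  ultimately show ?thesis
    using em_words_under[of "[]" 0 0 "{}" t "[]" "decreasing_perm (Suc (span t))"]
    by (simp add: egge_mansour_def labeled_squares_path)
qed

theorem corollary2p9:
  fixes n :: nat and p :: "step list" and \<pi> :: "nat \<Rightarrow> nat"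
  assumes "p \<in> schroeder_paths n"
    and "\<pi> = egge_mansour n p"
  shows "involution_on (n + 1) \<pi> \<longleftrightarrow> path_rev p = p"
proof -
  obtain t where t: "p = path t" "span t = n"
    using assms(1) by (rule schroeder_path_tree)
  let ?w = "decreasing_perm (Suc n)"
  have pi: "\<pi> = ?w \<circ> perm t"
    using assms(2) egge_mansour_path[of t] t by simp
  have perm: "\<pi> permutes {1..n + 1}"
    unfolding pi using perm_permutes[of t] t(2) decreasing_perm_permutes[of "Suc n"]
    by (simp add: permutes_compose)
  have mirror: "perm (mirror t) (?w (perm t i)) = ?w i" for i
    using inverse_pair_mirror[of t] t(2) by (simp add: inverse_pair_def)
  show ?thesis
  proof
    assume "involution_on (n + 1) \<pi>"
    then have "\<pi> (\<pi> i) = i" for i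
      using permutes_inverses(1)[OF perm] by (metis involution_on_def)
    then have inv: "perm t (?w (perm t i)) = ?w i" for i
      by (metis pi comp_apply decreasing_perm_decreasing_perm)
    have "perm (mirror t) = perm t"
    proof
      fix j
      obtain i where "j = ?w (perm t i)"
        using permutes_surj[OF perm] pi by (metis comp_apply surj_def)
      then show "perm (mirror t) j = perm t j" using mirror inv by simp
    qed
    then have "mirror t = t" by (rule perm_inject) (simp add: span_mirror)
    then show "path_rev p = p" using t path_mirror[of t] by simp
  next
    assume "path_rev p = p"
    then have "path (mirror t) = path t" using t by (simp add: path_mirror)
    then have "?w \<circ> perm (mirror t) = ?w \<circ> perm t"
      using egge_mansour_path[of t] egge_mansour_path[of "mirror t"] t(2)
      by (simp add: span_mirror)
    then have "perm (mirror t) = perm t"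
      by (metis comp_assoc decreasing_perm_involutive id_comp)
    then have "\<pi> \<circ> \<pi> = id" using mirror by (simp add: pi fun_eq_iff)
    then show "involution_on (n + 1) \<pi>"
      using perm inv_unique_comp by (metis involution_on_def)
  qed
qed

end
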